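(* Let $f,g:\mathbb{R}^n\to\mathbb{R}\cup\{\infty\}$ be closed, proper, convex functions. Assume the dual problem (D) is feasible and the primal problem (P) is strongly infeasible. Let $d'=-\Pi_{\overline{\mathrm{dom} f-\mathrm{dom} g}}(0)$. Then for any $\gamma>0$, \[ v=-d'=\Pi_{\overline{\mathrm{dom} f-\mathrm{dom} g}}(0)\neq 0 \] is the infimal displacement vector of the Douglas--Rachford operator $T_\gamma$. Furthermore, $d'$ is a dual improving direction.
   Context: A convex function is closed if its epigraph is closed, and proper if it is finite somewhere. $\mathrm{dom} f=\{x: f(x)<\infty\}$; $f^*$ is the convex conjugate; $\Pi_C$ is the Euclidean projection onto a nonempty closed convex set $C$; $\mathrm{Prox}_h(z)=\arg\min_x\{h(x)+\tfrac12\|x-z\|^2\}$. The recession function of a closed proper convex $h$ is $\mathrm{rec}(h)(d)=\lim_{\alpha\to\infty}\frac{h(x+\alpha d)-h(x)}{\alpha}$ for any $x\in\mathrm{dom} h$ (independent of $x$). (P): minimize $f(x)+g(x)$ over $x\in\mathbb{R}^n$; it is strongly infeasible if $0\notin\overline{\mathrm{dom} f-\mathrm{dom} g}$. (D): maximize $-f^*(\nu)-g^*(-\nu)$ over $\nu\in\mathbb{R}^n$; it is feasible if $0\in\mathrm{dom} f^*+\mathrm{dom} g^*$. A dual improving direction is a $d'\in\mathbb{R}^n$ with $\mathrm{rec}(f^* )(d')+\mathrm{rec}(g^* )(-d')<0$. The Douglas--Rachford operator is $T_\gamma=\frac12 I+\frac12(2\mathrm{Prox}_{\gamma g}-I)(2\mathrm{Prox}_{\gamma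 f}-I)$ (composition of operators). It is firmly nonexpansive, and $\overline{\mathrm{range}(I-T_\gamma)}$ is closed and convex; the infimal displacement vector of $T_\gamma$ is $\Pi_{\overline{\mathrm{range}(I-T_\gamma)}}(0)$, where $\mathrm{range}(I-T_\gamma)=\{z-T_\gamma(z): z\in\mathbb{R}^n\}$. *)

theory Defs
  imports "HOL-Analysis.Analysis"
begin

definition ext_epigraph :: "('a \<Rightarrow> ereal) \<Rightarrow> ('a \<times> real) set" where
  "ext_epigraph f = {(x, r). f x \<le> ereal r}"

definition eff_dom :: "('a \<Rightarrow> ereal) \<Rightarrow> 'a set" where
  "eff_dom f = {x. f x < \<infinity>}"

(* The first conjunct says that f takes values in the reals extended by plus infinity only;
   hence no undefined sum of infinities occurs in the convexity inequality below. *)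
definition proper_fun :: "('a \<Rightarrow> ereal) \<Rightarrow> bool" where
  "proper_fun f \<longleftrightarrow> (\<forall>x. f x \<noteq> -\<infinity>) \<and> (\<exists>x. \<bar>f x\<bar> \<noteq> \<infinity>)"

definition ext_convex :: "('a::real_vector \<Rightarrow> ereal) \<Rightarrow> bool" where
  "ext_convex f \<longleftrightarrow> (\<forall>x y. \<forall>t\<in>{0<..<1}.
     f ((1 - t) *\<^sub>R x + t *\<^sub>R y) \<le> ereal (1 - t) * f x + ereal t * f y)"

definition closed_proper_convex :: "('a::real_normed_vector \<Rightarrow> ereal) \<Rightarrow> bool" where
  "closed_proper_convex f \<longleftrightarrow> closed (ext_epigraph f) \<and> proper_fun f \<and> ext_convex f"

definition convex_conjugate :: "('a::real_inner \<Rightarrow> ereal) \<Rightarrow> 'a \<Rightarrow> ereal" where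
  "convex_conjugate f \<nu> = (SUP x. ereal (\<nu> \<bullet> x) - f x)"

(* The value is the common limit for all base points x in the effective domain;
   it exists whenever h is closed, proper and convex. *)
definition recession_fun :: "('a::real_vector \<Rightarrow> ereal) \<Rightarrow> 'a \<Rightarrow> ereal" where
  "recession_fun h d = (THE r. \<forall>x\<in>eff_dom h.
     ((\<lambda>\<alpha>::real. (h (x + \<alpha> *\<^sub>R d) - h x) / ereal \<alpha>) \<longlongrightarrow> r) at_top)"

(* Minkowski difference; the minus sign on sets is set-theoretic difference. *)
definition dom_diff :: "('a::minus \<Rightarrow> ereal) \<Rightarrow> ('a \<Rightarrow> ereal) \<Rightarrow> 'a set" where
  "dom_diff f g = {x - y | x y. x \<in> eff_dom f \<and> y \<in> eff_dom g}"

definition primal_strongly_infeasible ::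
    "('a::real_normed_vector \<Rightarrow> ereal) \<Rightarrow> ('a \<Rightarrow> ereal) \<Rightarrow> bool" where
  "primal_strongly_infeasible f g \<longleftrightarrow> 0 \<notin> closure (dom_diff f g)"

(* Here the plus sign on sets is the Minkowski sum. *)
definition dual_feasible :: "('a::real_inner \<Rightarrow> ereal) \<Rightarrow> ('a \<Rightarrow> ereal) \<Rightarrow> bool" where
  "dual_feasible f g \<longleftrightarrow> 0 \<in> eff_dom (convex_conjugate f) + eff_dom (convex_conjugate g)"

definition dual_improving_direction ::
    "('a::real_inner \<Rightarrow> ereal) \<Rightarrow> ('a \<Rightarrow> ereal) \<Rightarrow> 'a \<Rightarrow> bool" where
  "dual_improving_direction f g d \<longleftrightarrow>
     recession_fun (convex_conjugate f) d + recession_fun (convex_conjugate g) (- d) < 0"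

(* The minimizer is unique whenever h is closed, proper and convex on a Euclidean space. *)
definition prox :: "('a::real_normed_vector \<Rightarrow> ereal) \<Rightarrow> 'a \<Rightarrow> 'a" where
  "prox h z = (ARG_MIN (\<lambda>x. h x + ereal (1 / 2 * (norm (x - z))\<^sup>2)) x. True)"

definition reflected_prox :: "('a::real_normed_vector \<Rightarrow> ereal) \<Rightarrow> 'a \<Rightarrow> 'a" where
  "reflected_prox h z = 2 *\<^sub>R prox h z - z"

definition douglas_rachford ::
    "real \<Rightarrow> ('a::real_normed_vector \<Rightarrow> ereal) \<Rightarrow> ('a \<Rightarrow> ereal) \<Rightarrow> 'a \<Rightarrow> 'a" where
  "douglas_rachford \<gamma> f g z = (1 / 2) *\<^sub>R z + (1 / 2) *\<^sub>R
     (reflected_prox (\<lambda>x. ereal \<gamma> * g x) \<circ> reflected_prox (\<lambda>x. ereal \<gamma> * f x)) z"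

definition infimal_displacement :: "('a::euclidean_space \<Rightarrow> 'a) \<Rightarrow> 'a" where
  "infimal_displacement T = closest_point (closure (range (\<lambda>z. z - T z))) 0"

end

theory Submission
  imports Defs
begin

text \<open>
  Write \<open>F = \<gamma> f\<close>, \<open>G = \<gamma> g\<close>, \<open>T\<close> for the Douglas--Rachford operator, \<open>D\<close> for the closure of
  \<open>dom f - dom g\<close>, and \<open>v\<close> for the element of least norm of \<open>D\<close>; it is nonzero because \<open>0 \<notin> D\<close>.

  The displacement is \<open>z - T z = x - y\<close> with \<open>x = prox F z\<close> and \<open>y = prox G (2 x - z)\<close>. The two
  proximal points lie in the domains, so all displacements lie in \<open>D\<close>. Hence \<open>v\<close> is the infimal
  displacement vector as soon as it is a limit of displacements
  (lemma \<open>min_norm_in_closure_displacements\<close>).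

  To produce such displacements, let \<open>T z = (1 + \<epsilon>) z\<close> for a small \<open>\<epsilon> > 0\<close>. A fixed point argument
  gives \<open>z\<close>, since \<open>T\<close> is nonexpansive, and nonexpansiveness also keeps \<open>q = z - T z = - \<epsilon> z\<close> and
  \<open>\<epsilon> x\<close> bounded as \<open>\<epsilon> \<rightarrow> 0\<close>. Choose \<open>u \<in> dom f\<close> and \<open>w \<in> dom g\<close> with \<open>u - w\<close> close to \<open>v\<close>. Add the
  subgradient inequalities of \<open>F\<close> at \<open>x\<close> and of \<open>G\<close> at \<open>y\<close>, tested at \<open>u\<close> and \<open>w\<close>. A dual feasible
  point \<open>\<nu>\<close> supplies affine minorants of \<open>F\<close> and \<open>G\<close> with opposite slopes, so that
  \<open>F x + G y\<close> is bounded below by a function of \<open>q\<close> alone. After multiplication by \<open>\<epsilon>\<close> this leaves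
  \<open>\<parallel>q\<parallel>\<^sup>2 - q \<bullet> v \<le> \<epsilon> x \<bullet> v + (q + \<epsilon> x) \<bullet> (u - w - v) + O(\<epsilon>)\<close>. A hyperplane orthogonal to \<open>v\<close>
  separates the two domains, which bounds \<open>x \<bullet> v\<close> from above, so the right-hand side can be made
  arbitrarily small. The left-hand side is at least \<open>\<parallel>q - v\<parallel>\<^sup>2\<close>, because \<open>v \<bullet> q \<ge> \<parallel>v\<parallel>\<^sup>2\<close> on \<open>D\<close>.

  For the dual part, the recession function of \<open>f\<^sup>*\<close> at a direction in which \<open>dom f\<close> is bounded
  is the support function of \<open>dom f\<close> (lemma \<open>recession_fun_conjugate\<close>). With \<open>d' = - v\<close> the sum in
  question is therefore the supremum of \<open>d' \<bullet> p\<close> over \<open>p \<in> dom f - dom g\<close>, which is at most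
  \<open>- \<parallel>v\<parallel>\<^sup>2\<close>.
\<close>

section \<open>Domains, affine minorants and positive multiples\<close>

text \<open>
  Minorants are recorded with slope and constant because the argument needs the slopes of the two
  functions to be opposite; a finite value of the conjugate at \<open>\<nu>\<close> is a minorant of slope \<open>\<nu>\<close>.
\<close>

definition affine_minorant :: "('a::real_inner \<Rightarrow> ereal) \<Rightarrow> 'a \<Rightarrow> real \<Rightarrow> bool" where
  "affine_minorant h \<nu> a \<longleftrightarrow> (\<forall>x. ereal (\<nu> \<bullet> x - a) \<le> h x)"

lemma proper_point:
  assumes "proper_fun h"
  obtains x r where "h x = ereal r"
proof -
  obtain x where "\<bar>h x\<bar> \<noteq> \<infinity>" using assms unfolding proper_fun_def by (elim conjE exE)
  then show thesis using that by (cases "h x") auto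
qed

lemma eff_dom_real:
  assumes "proper_fun h" and "x \<in> eff_dom h"
  obtains r where "h x = ereal r"
  using assms unfolding proper_fun_def eff_dom_def
  by (cases "h x") auto

lemma eff_domI: "h x = ereal r \<Longrightarrow> x \<in> eff_dom h"
  by (simp add: eff_dom_def)

lemma eff_dom_nonempty:
  assumes "proper_fun h"
  shows "eff_dom h \<noteq> {}"
proof -
  obtain x r where "h x = ereal r" using assms by (rule proper_point)
  then show ?thesis by (auto dest: eff_domI)
qed

lemma convex_eff_dom:
  assumes "ext_convex h"
  shows "convex (eff_dom h)"
  unfolding convex_alt
proof clarify
  fix x y and t :: real
  assume x: "x \<in> eff_dom h" and y: "y \<in> eff_dom h" and t: "0 \<le> t" "t \<le> 1"
  show "(1 - t) *\<^sub>R x + t *\<^sub>R y \<in> eff_dom h"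
  proof (cases "t \<in> {0<..<1}")
    case True
    then have "h ((1 - t) *\<^sub>R x + t *\<^sub>R y) \<le> ereal (1 - t) * h x + ereal t * h y"
      using assms by (auto simp: ext_convex_def)
    also have "\<dots> < \<infinity>"
      using x y True by (cases "h x"; cases "h y") (auto simp: eff_dom_def)
    finally show ?thesis by (simp add: eff_dom_def)
  next
    case False
    then have "t = 0 \<or> t = 1" using t by auto
    then show ?thesis using x y by auto
  qed
qed

lemma convex_dom_diff:
  assumes "ext_convex f" and "ext_convex g"
  shows "convex (dom_diff f g)"
proof -
  have "dom_diff f g = (\<Union>x\<in>eff_dom f. \<Union>y\<in>eff_dom g. {x - y})"
    by (auto simp: dom_diff_def)
  then show ?thesis
    using convex_differences[OF assms[THEN convex_eff_dom]] by simp
qed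

lemma conjugate_affine_minorant:
  assumes "proper_fun f" and "\<nu> \<in> eff_dom (convex_conjugate f)"
  obtains a where "convex_conjugate f \<nu> = ereal a" and "affine_minorant f \<nu> a"
proof -
  have le: "ereal (\<nu> \<bullet> x) - f x \<le> convex_conjugate f \<nu>" for x
    unfolding convex_conjugate_def by (rule SUP_upper) simp
  obtain x0 r0 where x0: "f x0 = ereal r0" using assms(1) by (rule proper_point)
  have "convex_conjugate f \<nu> \<noteq> -\<infinity>" using le[of x0] x0 by auto
  then obtain a where a: "convex_conjugate f \<nu> = ereal a"
    using assms(2) by (cases "convex_conjugate f \<nu>") (auto simp: eff_dom_def)
  have "ereal (\<nu> \<bullet> x - a) \<le> f x" for x
    using le[of x] a by (cases "f x") auto
  with a that show thesis by (auto simp: affine_minorant_def)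
qed

lemma closed_proper_convex_cmult:
  assumes h: "closed_proper_convex h" and \<gamma>: "0 < \<gamma>"
  shows "closed_proper_convex (\<lambda>x. ereal \<gamma> * h x)"
proof -
  have "ereal \<gamma> * h x \<le> ereal r \<longleftrightarrow> h x \<le> ereal (r / \<gamma>)" for x r
    using \<gamma> by (cases "h x") (auto simp: field_simps)
  then have "ext_epigraph (\<lambda>x. ereal \<gamma> * h x) = (\<lambda>s. (fst s, snd s / \<gamma>)) -` ext_epigraph h"
    by (auto simp: ext_epigraph_def)
  moreover have "closed ((\<lambda>s. (fst s, snd s / \<gamma>)) -` ext_epigraph h)"
    using h \<gamma> by (intro closed_vimage continuous_intros) (auto simp: closed_proper_convex_def)
  ultimately have 1: "closed (ext_epigraph (\<lambda>x. ereal \<gamma> * h x))" by simp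
  have 2: "proper_fun (\<lambda>x. ereal \<gamma> * h x)"
    unfolding proper_fun_def
  proof
    have proper: "proper_fun h" using h by (simp add: closed_proper_convex_def)
    then show "\<forall>x. ereal \<gamma> * h x \<noteq> - \<infinity>"
      using \<gamma> by (simp add: proper_fun_def ereal_mult_eq_MInfty)
    obtain x r where "h x = ereal r" using proper by (rule proper_point)
    then show "\<exists>x. \<bar>ereal \<gamma> * h x\<bar> \<noteq> \<infinity>" by (intro exI[of _ x]) simp
  qed
  have "ext_convex (\<lambda>x. ereal \<gamma> * h x)"
    unfolding ext_convex_def
  proof (intro allI ballI)
    fix x y and t :: real assume t: "t \<in> {0<..<1}"
    have "h ((1 - t) *\<^sub>R x + t *\<^sub>R y) \<le> ereal (1 - t) * h x + ereal t * h y"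
      using h t by (auto simp: closed_proper_convex_def ext_convex_def)
    then have "ereal \<gamma> * h ((1 - t) *\<^sub>R x + t *\<^sub>R y) \<le> ereal \<gamma> * (ereal (1 - t) * h x + ereal t * h y)"
      using \<gamma> by (intro ereal_mult_left_mono) auto
    also have "\<dots> = ereal (1 - t) * (ereal \<gamma> * h x) + ereal t * (ereal \<gamma> * h y)"
      using t \<gamma> by (cases "h x"; cases "h y") (auto simp: algebra_simps)
    finally show "ereal \<gamma> * h ((1 - t) *\<^sub>R x + t *\<^sub>R y)
        \<le> ereal (1 - t) * (ereal \<gamma> * h x) + ereal t * (ereal \<gamma> * h y)" .
  qed
  with 1 2 show ?thesis by (simp add: closed_proper_convex_def)
qed

lemma affine_minorant_cmult:
  assumes "affine_minorant h \<nu> a" and "0 < \<gamma>"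
  shows "affine_minorant (\<lambda>x. ereal \<gamma> * h x) (\<gamma> *\<^sub>R \<nu>) (\<gamma> * a)"
  unfolding affine_minorant_def
proof
  fix x
  have "ereal \<gamma> * ereal (\<nu> \<bullet> x - a) \<le> ereal \<gamma> * h x"
    using assms by (intro ereal_mult_left_mono) (auto simp: affine_minorant_def)
  then show "ereal ((\<gamma> *\<^sub>R \<nu>) \<bullet> x - \<gamma> * a) \<le> ereal \<gamma> * h x"
    by (simp add: algebra_simps)
qed

lemma eff_dom_cmult:
  assumes "0 < \<gamma>"
  shows "eff_dom (\<lambda>x. ereal \<gamma> * h x) = eff_dom h"
  using assms unfolding eff_dom_def
  by (auto simp: less_top[symmetric] top_ereal_def ereal_mult_eq_PInfty)

section \<open>The proximal operator\<close>

text \<open>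
  The quadratic term dominates the affine minorant, so sublevel sets are bounded. The minimum is
  taken over a piece of the epigraph, where the objective becomes continuous and closedness of the
  epigraph plays the part of lower semicontinuity of \<open>h\<close>.
\<close>

lemma prox_minimizer_exists:
  fixes h :: "'a::euclidean_space \<Rightarrow> ereal"
  assumes "closed (ext_epigraph h)" and "proper_fun h" and "affine_minorant h \<nu> a"
  shows "\<exists>p. \<forall>u. h p + ereal (1 / 2 * (norm (p - z))\<^sup>2) \<le> h u + ereal (1 / 2 * (norm (u - z))\<^sup>2)"
proof -
  obtain x0 r0 where x0: "h x0 = ereal r0" using assms(2) by (rule proper_point)
  define \<phi> where "\<phi> = (\<lambda>(x, r). r + 1 / 2 * (norm (x - z :: 'a))\<^sup>2)"
  define M where "M = \<phi> (x0, r0)"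
  define S where "S = ext_epigraph h \<inter> {s. \<phi> s \<le> M}"
  have cont: "continuous_on UNIV \<phi>"
    unfolding \<phi>_def case_prod_beta by (intro continuous_intros)
  have "closed {s. \<phi> s \<le> M}"
    using cont by (intro closed_Collect_le continuous_intros)
  then have closed: "closed S" using assms(1) by (auto simp: S_def)
  have minor: "\<nu> \<bullet> x - a \<le> r" if "(x, r) \<in> S" for x r
  proof -
    have "ereal (\<nu> \<bullet> x - a) \<le> h x" using assms(3) by (auto simp: affine_minorant_def)
    also have "\<dots> \<le> ereal r" using that by (auto simp: S_def ext_epigraph_def)
    finally show ?thesis by simp
  qed
  \<comment> \<open>The value of \<open>R\<close> comes from absorbing \<open>\<nu> \<bullet> (x - z)\<close> into a quarter of the square.\<close>
  define R where "R = M + a - \<nu> \<bullet> z + (norm \<nu>)\<^sup>2"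
  have fst_bound: "(norm (x - z))\<^sup>2 \<le> 4 * R" if "(x, r) \<in> S" for x r
  proof -
    have "\<nu> \<bullet> x - a + 1 / 2 * (norm (x - z))\<^sup>2 \<le> M"
      using minor[OF that] that by (auto simp: S_def \<phi>_def)
    moreover have "\<nu> \<bullet> z - \<nu> \<bullet> x \<le> (norm \<nu>)\<^sup>2 + 1 / 4 * (norm (x - z))\<^sup>2"
    proof -
      have "(norm (\<nu> + (1 / 2) *\<^sub>R c))\<^sup>2 = (norm \<nu>)\<^sup>2 + \<nu> \<bullet> c + 1 / 4 * (norm c)\<^sup>2" for c
        unfolding power2_norm_eq_inner
        by (simp add: inner_add_left inner_add_right inner_commute[of c \<nu>] field_simps)
      from this[of "x - z"] show ?thesis
        using zero_le_power2[of "norm (\<nu> + (1 / 2) *\<^sub>R (x - z))"]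
        unfolding inner_diff_right by linarith
    qed
    ultimately show ?thesis unfolding R_def by (simp add: algebra_simps)
  qed
  have "bounded S"
  proof (rule bounded_subset)
    show "S \<subseteq> cball z (sqrt (4 * R)) \<times> {- norm \<nu> * (norm z + sqrt (4 * R)) - a .. M}"
    proof clarify
      fix x r assume s: "(x, r) \<in> S"
      have nx: "norm (x - z) \<le> sqrt (4 * R)"
        using fst_bound[OF s] by (rule real_le_rsqrt)
      have "norm x \<le> norm z + sqrt (4 * R)"
        using nx norm_triangle_sub[of x z] by linarith
      then have "norm \<nu> * norm x \<le> norm \<nu> * (norm z + sqrt (4 * R))"
        by (rule mult_left_mono) simp
      moreover have "- (norm \<nu> * norm x) \<le> \<nu> \<bullet> x"
        using Cauchy_Schwarz_ineq2[of \<nu> x] by linarith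
      moreover have "r \<le> M" using s by (auto simp: S_def \<phi>_def intro: order_trans[rotated])
      ultimately show "x \<in> cball z (sqrt (4 * R)) \<and> r \<in> {- norm \<nu> * (norm z + sqrt (4 * R)) - a .. M}"
        using minor[OF s] nx by (auto simp: dist_norm norm_minus_commute)
    qed
  qed (simp add: bounded_Times)
  with closed have compact: "compact S" by (simp add: compact_eq_bounded_closed)
  have "(x0, r0) \<in> S" using x0 by (auto simp: S_def M_def ext_epigraph_def)
  then have "S \<noteq> {}" by blast
  from continuous_attains_inf[OF compact this continuous_on_subset[OF cont subset_UNIV]]
  obtain p r where pr: "(p, r) \<in> S" and min: "\<And>s. s \<in> S \<Longrightarrow> \<phi> (p, r) \<le> \<phi> s"
    by (metis surj_pair)
  have hp: "h p \<le> ereal r" using pr by (auto simp: S_def ext_epigraph_def)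
  have "h p + ereal (1 / 2 * (norm (p - z))\<^sup>2) \<le> h u + ereal (1 / 2 * (norm (u - z))\<^sup>2)" for u
  proof -
    have "ereal (\<phi> (p, r)) \<le> h u + ereal (1 / 2 * (norm (u - z))\<^sup>2)"
    proof (cases "h u")
      case (real s)
      have "\<phi> (p, r) \<le> \<phi> (u, s)"
      proof (cases "(u, s) \<in> S")
        case False
        then have "M < \<phi> (u, s)" using real by (auto simp: S_def ext_epigraph_def)
        moreover have "\<phi> (p, r) \<le> M" using pr by (auto simp: S_def)
        ultimately show ?thesis by linarith
      qed (rule min)
      then show ?thesis using real by (simp add: \<phi>_def)
    next
      case MInf
      then show ?thesis using assms(2) by (auto simp: proper_fun_def)
    qed simp
    moreover have "h p + ereal (1 / 2 * (norm (p - z))\<^sup>2) \<le> ereal r + ereal (1 / 2 * (norm (p - z))\<^sup>2)"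
      by (rule add_right_mono[OF hp])
    ultimately show ?thesis by (auto simp: \<phi>_def)
  qed
  then show ?thesis by blast
qed

text \<open>
  The optimality condition \<open>z - prox h z \<in> \<partial> h (prox h z)\<close>. Minimality is compared with the points
  \<open>(1 - t) p + t u\<close> of a segment; convexity makes the inequality linear in \<open>t\<close> up to a term of
  order \<open>t\<^sup>2\<close>, and one divides by \<open>t\<close> and lets \<open>t\<close> tend to 0.
\<close>

lemma prox_subgradient:
  fixes h :: "'a::euclidean_space \<Rightarrow> ereal"
  assumes h: "closed_proper_convex h" and minor: "affine_minorant h \<nu> a"
  obtains r where "h (prox h z) = ereal r"
    and "\<forall>u. ereal (r + (z - prox h z) \<bullet> (u - prox h z)) \<le> h u"
proof -
  let ?\<phi> = "\<lambda>x. h x + ereal (1 / 2 * (norm (x - z))\<^sup>2)"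
  define p where "p = prox h z"
  have proper: "proper_fun h" and conv: "ext_convex h"
    using h by (auto simp: closed_proper_convex_def)
  obtain q where "\<And>u. ?\<phi> q \<le> ?\<phi> u"
    using prox_minimizer_exists[OF _ proper minor] h by (metis closed_proper_convex_def)
  then have "is_arg_min ?\<phi> (\<lambda>_. True) q" by (auto simp: is_arg_min_def not_less)
  then have "is_arg_min ?\<phi> (\<lambda>_. True) p"
    unfolding p_def prox_def arg_min_def by (rule someI)
  then have min: "?\<phi> p \<le> ?\<phi> u" for u by (auto simp: is_arg_min_def not_less)
  obtain x0 r0 where "h x0 = ereal r0" using proper by (rule proper_point)
  with min[of x0] obtain r where r: "h p = ereal r"
    using proper by (cases "h p") (auto simp: proper_fun_def)
  have "ereal (r + (z - p) \<bullet> (u - p)) \<le> h u" for u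
  proof (cases "h u")
    case (real s)
    have step: "r + (z - p) \<bullet> (u - p) \<le> s + t * (norm (u - p))\<^sup>2" if t: "t \<in> {0<..<1}" for t
    proof -
      define m where "m = (1 - t) *\<^sub>R p + t *\<^sub>R u"
      have "h m \<le> ereal (1 - t) * h p + ereal t * h u"
        using conv t by (auto simp: ext_convex_def m_def)
      then have hm: "h m \<le> ereal ((1 - t) * r + t * s)" using r real by simp
      have "?\<phi> p \<le> ?\<phi> m" by (rule min)
      also have "\<dots> \<le> ereal ((1 - t) * r + t * s) + ereal (1 / 2 * (norm (m - z))\<^sup>2)"
        by (rule add_right_mono[OF hm])
      finally have "r + 1 / 2 * (norm (p - z))\<^sup>2
          \<le> (1 - t) * r + t * s + 1 / 2 * (norm (m - z))\<^sup>2"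
        using r by simp
      moreover have "(norm (m - z))\<^sup>2
          = (norm (p - z))\<^sup>2 - 2 * t * ((z - p) \<bullet> (u - p)) + t\<^sup>2 * (norm (u - p))\<^sup>2"
      proof -
        have "(norm (t *\<^sub>R c - e))\<^sup>2 = (norm e)\<^sup>2 - 2 * t * (e \<bullet> c) + t\<^sup>2 * (norm c)\<^sup>2" for c e :: 'a
          unfolding power2_norm_eq_inner
          by (simp add: inner_commute inner_diff_left inner_diff_right algebra_simps power2_eq_square)
        moreover have "m - z = t *\<^sub>R (u - p) - (z - p)" by (simp add: m_def algebra_simps)
        ultimately show ?thesis by (simp only: norm_minus_commute[of p z])
      qed
      ultimately have "t * (r + (z - p) \<bullet> (u - p)) \<le> t * s + 1 / 2 * (t\<^sup>2 * (norm (u - p))\<^sup>2)"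
        by (simp add: algebra_simps)
      also have "\<dots> \<le> t * s + t\<^sup>2 * (norm (u - p))\<^sup>2" by simp
      also have "\<dots> = t * (s + t * (norm (u - p))\<^sup>2)"
        by (simp add: algebra_simps power2_eq_square)
      finally show ?thesis using t by (simp add: mult_le_cancel_left)
    qed
    have "((\<lambda>t. s + t * (norm (u - p))\<^sup>2) \<longlongrightarrow> s + 0 * (norm (u - p))\<^sup>2) (at_right 0)"
      by (intro tendsto_intros)
    moreover have "eventually (\<lambda>t. r + (z - p) \<bullet> (u - p) \<le> s + t * (norm (u - p))\<^sup>2) (at_right 0)"
      unfolding eventually_at_right_field using step by (intro exI[of _ 1]) auto
    ultimately have "r + (z - p) \<bullet> (u - p) \<le> s + 0 * (norm (u - p))\<^sup>2"
      by (intro tendsto_lowerbound) (auto simp: trivial_limit_at_right_real)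
    then show ?thesis using real by simp
  next
    case MInf
    then show ?thesis using proper by (auto simp: proper_fun_def)
  qed simp
  with r that show thesis by (simp add: p_def)
qed

lemma prox_in_eff_dom:
  fixes h :: "'a::euclidean_space \<Rightarrow> ereal"
  assumes "closed_proper_convex h" and "affine_minorant h \<nu> a"
  shows "prox h z \<in> eff_dom h"
proof -
  obtain r where "h (prox h z) = ereal r" using prox_subgradient[OF assms, of z] .
  then show ?thesis by (rule eff_domI)
qed

text \<open>Monotonicity of the subdifferential: each of the two points is tested at the other.\<close>

lemma prox_firmly_nonexpansive:
  fixes h :: "'a::euclidean_space \<Rightarrow> ereal"
  assumes "closed_proper_convex h" and "affine_minorant h \<nu> a"
  shows "(norm (prox h z - prox h w))\<^sup>2 \<le> (prox h z - prox h w) \<bullet> (z - w)"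
proof -
  obtain r where r: "h (prox h z) = ereal r"
    "\<forall>u. ereal (r + (z - prox h z) \<bullet> (u - prox h z)) \<le> h u"
    using prox_subgradient[OF assms, of z] .
  obtain s where s: "h (prox h w) = ereal s"
    "\<forall>u. ereal (s + (w - prox h w) \<bullet> (u - prox h w)) \<le> h u"
    using prox_subgradient[OF assms, of w] .
  have "(z - prox h z) \<bullet> (prox h w - prox h z) + (w - prox h w) \<bullet> (prox h z - prox h w) \<le> 0"
    using r(2)[rule_format, of "prox h w"] s(2)[rule_format, of "prox h z"] r(1) s(1) by simp
  then show ?thesis
    unfolding power2_norm_eq_inner
    by (simp add: inner_diff_left inner_diff_right inner_commute)
qed

lemma prox_nonexpansive:
  fixes h :: "'a::euclidean_space \<Rightarrow> ereal"
  assumes "closed_proper_convex h" and "affine_minorant h \<nu> a"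
  shows "norm (prox h z - prox h w) \<le> norm (z - w)"
proof -
  have "norm (prox h z - prox h w) * norm (prox h z - prox h w)
      \<le> norm (prox h z - prox h w) * norm (z - w)"
    using prox_firmly_nonexpansive[OF assms, of z w] norm_cauchy_schwarz[of "prox h z - prox h w" "z - w"]
    by (simp add: power2_eq_square)
  then show ?thesis by (cases "prox h z = prox h w") auto
qed

lemma reflected_prox_nonexpansive:
  fixes h :: "'a::euclidean_space \<Rightarrow> ereal"
  assumes "closed_proper_convex h" and "affine_minorant h \<nu> a"
  shows "norm (reflected_prox h z - reflected_prox h w) \<le> norm (z - w)"
proof (rule power2_le_imp_le)
  let ?p = "prox h z - prox h w"
  have "reflected_prox h z - reflected_prox h w = 2 *\<^sub>R ?p - (z - w)"
    by (simp add: reflected_prox_def algebra_simps)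
  moreover have "(norm (2 *\<^sub>R c - e))\<^sup>2 = 4 * (norm c)\<^sup>2 - 4 * (c \<bullet> e) + (norm e)\<^sup>2" for c e :: 'a
    unfolding power2_norm_eq_inner
    by (simp add: inner_commute inner_diff_left inner_diff_right algebra_simps)
  ultimately have "(norm (reflected_prox h z - reflected_prox h w))\<^sup>2
      = 4 * (norm ?p)\<^sup>2 - 4 * (?p \<bullet> (z - w)) + (norm (z - w))\<^sup>2"
    by simp
  then show "(norm (reflected_prox h z - reflected_prox h w))\<^sup>2 \<le> (norm (z - w))\<^sup>2"
    using prox_firmly_nonexpansive[OF assms, of z w] by simp
qed simp

section \<open>Resolvents of displacements\<close>

text \<open>
  Although \<open>I - T\<close> itself need not have a zero, \<open>I - T + \<epsilon> I\<close> has one, as the fixed point of the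
  contraction \<open>T / (1 + \<epsilon>)\<close>. The bound on \<open>\<epsilon> z\<close> is uniform in \<open>\<epsilon>\<close>.
\<close>

lemma nonexpansive_displacement_resolvent:
  fixes T :: "'a::{complete_space,real_normed_vector} \<Rightarrow> 'a"
  assumes nonexp: "\<And>x y. norm (T x - T y) \<le> norm (x - y)" and \<epsilon>: "0 < \<epsilon>"
  obtains z where "z - T z = - \<epsilon> *\<^sub>R z" and "\<epsilon> * norm z \<le> norm (T 0)"
proof -
  define c where "c = 1 / (1 + \<epsilon>)"
  have c: "0 \<le> c" "c < 1" using \<epsilon> by (auto simp: c_def)
  have "dist (c *\<^sub>R T x) (c *\<^sub>R T y) \<le> c * dist x y" for x y
    using nonexp[of x y] c(1) by (simp add: dist_norm mult_left_mono flip: scaleR_diff_right)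
  then obtain z where "c *\<^sub>R T z = z"
    using banach_fix_type[of c "\<lambda>x. c *\<^sub>R T x"] c by auto
  then have "T z = (1 + \<epsilon>) *\<^sub>R z"
    using \<epsilon> by (auto simp: c_def divide_simps dest: arg_cong[of _ _ "scaleR (1 + \<epsilon>)"])
  moreover from this have "(1 + \<epsilon>) * norm z \<le> norm (T 0) + norm z"
    using nonexp[of z 0] norm_triangle_sub[of "T z" "T 0"] \<epsilon> by simp
  ultimately show thesis
    by (intro that[of z]) (auto simp: algebra_simps)
qed

section \<open>Displacements of the Douglas--Rachford operator\<close>

lemma douglas_rachford_displacement:
  "z - douglas_rachford \<gamma> f g z = prox (\<lambda>x. ereal \<gamma> * f x) z
     - prox (\<lambda>x. ereal \<gamma> * g x) (2 *\<^sub>R prox (\<lambda>x. ereal \<gamma> * f x) z - z)"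
proof -
  have "z = (1/2) *\<^sub>R z + (1/2) *\<^sub>R z" by (simp flip: scaleR_left_distrib)
  then show ?thesis
    unfolding douglas_rachford_def reflected_prox_def by (simp add: scaleR_diff_right algebra_simps)
qed

lemma douglas_rachford_nonexpansive:
  fixes f g :: "'a::euclidean_space \<Rightarrow> ereal"
  assumes "closed_proper_convex (\<lambda>x. ereal \<gamma> * f x)" "affine_minorant (\<lambda>x. ereal \<gamma> * f x) \<nu> a"
    and "closed_proper_convex (\<lambda>x. ereal \<gamma> * g x)" "affine_minorant (\<lambda>x. ereal \<gamma> * g x) \<mu> b"
  shows "norm (douglas_rachford \<gamma> f g z - douglas_rachford \<gamma> f g w) \<le> norm (z - w)"
proof -
  let ?R = "\<lambda>z. reflected_prox (\<lambda>x. ereal \<gamma> * g x) (reflected_prox (\<lambda>x. ereal \<gamma> * f x) z)"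
  have "norm (?R z - ?R w) \<le> norm (z - w)"
    using reflected_prox_nonexpansive[OF assms(1,2)] reflected_prox_nonexpansive[OF assms(3,4)]
    by (rule order_trans[rotated])
  moreover have "douglas_rachford \<gamma> f g z - douglas_rachford \<gamma> f g w
      = (1 / 2) *\<^sub>R (z - w) + (1 / 2) *\<^sub>R (?R z - ?R w)"
    by (simp add: douglas_rachford_def algebra_simps)
  ultimately show ?thesis
    using norm_triangle_ineq[of "(1 / 2) *\<^sub>R (z - w)" "(1 / 2) *\<^sub>R (?R z - ?R w)"] by simp
qed

text \<open>
  The two hypotheses on \<open>v\<close> characterise it as the projection of 0 onto the
  closure of the difference of the domains; the opposite slopes \<open>\<nu>\<close> and \<open>- \<nu>\<close> express dual
  feasibility. The points \<open>u\<close>, \<open>w\<close> are fixed first, since \<open>F u + G w\<close> may blow up as \<open>u - w\<close>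
  approaches \<open>v\<close>; only then is \<open>\<epsilon>\<close> chosen small in terms of them.
\<close>

lemma min_norm_in_closure_displacements:
  fixes F G :: "'a::euclidean_space \<Rightarrow> ereal" and v :: 'a
  assumes F: "closed_proper_convex F" "affine_minorant F \<nu> a"
    and G: "closed_proper_convex G" "affine_minorant G (- \<nu>) b"
    and v: "v \<in> closure (dom_diff F G)"
    and vmin: "\<And>d. d \<in> dom_diff F G \<Longrightarrow> (norm v)\<^sup>2 \<le> v \<bullet> d"
    and T: "\<And>z. z - T z = prox F z - prox G (2 *\<^sub>R prox F z - z)"
    and nonexp: "\<And>z w. norm (T z - T w) \<le> norm (z - w)"
  shows "v \<in> closure (range (\<lambda>z. z - T z))"
proof -
  have "\<exists>z. (norm (z - T z - v))\<^sup>2 < \<eta>" if \<eta>: "0 < \<eta>" for \<eta>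
  proof -
    have proper: "proper_fun F" "proper_fun G"
      using F G by (auto simp: closed_proper_convex_def)
    \<comment> \<open>\<open>K\<close> bounds \<open>\<parallel>q\<parallel> + \<parallel>\<epsilon> x\<parallel>\<close> independently of \<open>\<epsilon>\<close>, \<open>u\<close>, \<open>w\<close>; the summand 1 allows
      division by \<open>K\<close>.\<close>
    define K where "K = 2 * norm (T 0) + norm (prox F 0) + 1"
    have K: "0 < K" by (simp add: K_def add_nonneg_pos)
    obtain u w where u: "u \<in> eff_dom F" and w: "w \<in> eff_dom G"
      and \<delta>: "norm (u - w - v) < \<eta> / (2 * K)"
    proof -
      have "0 < \<eta> / (2 * K)" using \<eta> K by simp
      then show thesis
        using v that unfolding closure_approachable dom_diff_def dist_norm by blast
    qed
    obtain Fu where Fu: "F u = ereal Fu" using eff_dom_real[OF proper(1) u] .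
    obtain Gw where Gw: "G w = ereal Gw" using eff_dom_real[OF proper(2) w] .
    \<comment> \<open>\<open>M\<close> collects every term that is multiplied by \<open>\<epsilon>\<close> in the final estimate.\<close>
    define M where "M = \<bar>Fu + Gw + a + b\<bar> + norm \<nu> * K + norm w * K + \<bar>v \<bullet> u\<bar> + norm v * K"
    have M: "0 \<le> M" using K by (simp add: M_def)
    define \<epsilon> where "\<epsilon> = min 1 (\<eta> / (2 * (M + 1)))"
    have \<epsilon>: "0 < \<epsilon>" "\<epsilon> \<le> 1" "\<epsilon> * M < \<eta> / 2"
    proof -
      show "0 < \<epsilon>" "\<epsilon> \<le> 1" using \<eta> M by (auto simp: \<epsilon>_def)
      have "\<epsilon> * M < \<epsilon> * (M + 1)" using \<open>0 < \<epsilon>\<close> by simp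
      also have "\<dots> \<le> (\<eta> / (2 * (M + 1))) * (M + 1)"
        using M by (intro mult_right_mono) (auto simp: \<epsilon>_def)
      also have "\<dots> = \<eta> / 2" using M by (simp add: field_simps)
      finally show "\<epsilon> * M < \<eta> / 2" .
    qed
    obtain z where z: "z - T z = - \<epsilon> *\<^sub>R z" and znorm: "\<epsilon> * norm z \<le> norm (T 0)"
      using nonexpansive_displacement_resolvent[OF nonexp \<epsilon>(1)] .
    define x where "x = prox F z"
    define y where "y = prox G (2 *\<^sub>R x - z)"
    define q where "q = x - y"
    have zq: "z - T z = q" using T[of z] by (simp add: q_def x_def y_def)
    with z have qz: "q = - \<epsilon> *\<^sub>R z" by simp
    obtain r where r: "F x = ereal r" "\<forall>t. ereal (r + (z - x) \<bullet> (t - x)) \<le> F t"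
      using prox_subgradient[OF F, of z] unfolding x_def .
    obtain s where s: "G y = ereal s" "\<forall>t. ereal (s + (2 *\<^sub>R x - z - y) \<bullet> (t - y)) \<le> G t"
      using prox_subgradient[OF G, of "2 *\<^sub>R x - z"] unfolding y_def .
    have qnorm: "norm q \<le> norm (T 0)" using qz znorm \<epsilon>(1) by simp
    have xnorm: "\<epsilon> * norm x \<le> norm (T 0) + norm (prox F 0)"
    proof -
      have "norm x \<le> norm (prox F 0) + norm z"
        using prox_nonexpansive[OF F, of z 0] norm_triangle_sub[of x "prox F 0"] by (simp add: x_def)
      then have "\<epsilon> * norm x \<le> \<epsilon> * norm (prox F 0) + \<epsilon> * norm z"
        using \<epsilon>(1) by (simp flip: distrib_left)
      moreover have "\<epsilon> * norm (prox F 0) \<le> norm (prox F 0)"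
        using \<epsilon> by (intro mult_left_le_one_le) auto
      ultimately show ?thesis using znorm by linarith
    qed
    have qK: "norm q \<le> K"
      using qnorm norm_ge_zero[of "T 0"] norm_ge_zero[of "prox F 0"] unfolding K_def by linarith
    have dom: "x \<in> eff_dom F" "y \<in> eff_dom G" using r(1) s(1) by (auto intro: eff_domI)
    have vq: "(norm v)\<^sup>2 \<le> v \<bullet> q"
      using vmin dom by (auto simp: q_def dom_diff_def)
    have vuy: "(norm v)\<^sup>2 \<le> v \<bullet> (u - y)"
      using vmin[of "u - y"] dom u by (auto simp: dom_diff_def)
    \<comment> \<open>The point \<open>x\<close> may escape to infinity like \<open>1 / \<epsilon>\<close>, but not in the direction of \<open>v\<close>:
      \<open>x = y + q\<close>, and \<open>v \<bullet> y\<close> is bounded above on \<open>dom G\<close> by separation.\<close>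
    have vx: "v \<bullet> x \<le> \<bar>v \<bullet> u\<bar> + norm v * K"
    proof -
      have "v \<bullet> x = v \<bullet> u - v \<bullet> (u - y) + v \<bullet> q" by (simp add: q_def inner_diff_right)
      moreover have "0 \<le> v \<bullet> (u - y)" using vuy order_trans zero_le_power2 by blast
      moreover have "v \<bullet> q \<le> norm v * norm q" by (rule norm_cauchy_schwarz)
      moreover have "norm v * norm q \<le> norm v * K" using qK by (rule mult_left_mono) simp
      ultimately show ?thesis by linarith
    qed
    have sub: "r + s + (z - x) \<bullet> (u - x) + (2 *\<^sub>R x - z - y) \<bullet> (w - y) \<le> Fu + Gw"
      using r(2)[rule_format, of u] s(2)[rule_format, of w] Fu Gw by simp
    have minor: "\<nu> \<bullet> q - a - b \<le> r + s"
    proof -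
      have "\<nu> \<bullet> x - a \<le> r" "- \<nu> \<bullet> y - b \<le> s"
        using F(2) G(2) r(1) s(1) by (metis affine_minorant_def ereal_less_eq(3))+
      then show ?thesis by (simp add: q_def inner_diff_right)
    qed
    have expand: "(z - x) \<bullet> (u - x) + (2 *\<^sub>R x - z - y) \<bullet> (w - y)
        = z \<bullet> (u - w) - z \<bullet> q + (norm q)\<^sup>2 + q \<bullet> w - x \<bullet> (u - w)"
      unfolding q_def power2_norm_eq_inner
      by (simp add: inner_commute inner_diff_left inner_diff_right algebra_simps)
    have "z \<bullet> (u - w) - z \<bullet> q \<le> Fu + Gw + a + b - \<nu> \<bullet> q - q \<bullet> w + x \<bullet> (u - w)"
      using sub minor expand zero_le_power2[of "norm q"] by linarith
    then have "\<epsilon> * (z \<bullet> (u - w) - z \<bullet> q)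
        \<le> \<epsilon> * (Fu + Gw + a + b - \<nu> \<bullet> q - q \<bullet> w + x \<bullet> (u - w))"
      using \<epsilon>(1) by (intro mult_left_mono) auto
    moreover have "\<epsilon> * (z \<bullet> (u - w) - z \<bullet> q) = q \<bullet> q - q \<bullet> (u - w)"
      by (simp add: qz algebra_simps)
    \<comment> \<open>The point \<open>u - w\<close> is split as \<open>v + (u - w - v)\<close>.\<close>
    ultimately have main: "q \<bullet> q - q \<bullet> v
        \<le> \<epsilon> * (Fu + Gw + a + b - \<nu> \<bullet> q - q \<bullet> w + v \<bullet> x) + (q + \<epsilon> *\<^sub>R x) \<bullet> (u - w - v)"
      by (simp add: inner_commute inner_diff_right inner_add_right algebra_simps)
    have "(norm (q - v))\<^sup>2 = q \<bullet> q - q \<bullet> v - (v \<bullet> q - (norm v)\<^sup>2)"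
      unfolding power2_norm_eq_inner by (simp add: inner_commute inner_diff_left inner_diff_right)
    also have "\<dots> \<le> q \<bullet> q - q \<bullet> v" using vq by simp
    also note main
    also have "\<epsilon> * (Fu + Gw + a + b - \<nu> \<bullet> q - q \<bullet> w + v \<bullet> x) + (q + \<epsilon> *\<^sub>R x) \<bullet> (u - w - v)
        \<le> \<epsilon> * M + K * (\<eta> / (2 * K))"
    proof (rule add_mono)
      have "- (\<nu> \<bullet> q) \<le> norm \<nu> * norm q"
        using Cauchy_Schwarz_ineq2[of \<nu> q] by linarith
      also have "\<dots> \<le> norm \<nu> * K" using qK by (rule mult_left_mono) simp
      finally have 1: "- (\<nu> \<bullet> q) \<le> norm \<nu> * K" .
      have "- (q \<bullet> w) \<le> norm w * norm q"
        using Cauchy_Schwarz_ineq2[of w q] by (simp add: inner_commute)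
      also have "\<dots> \<le> norm w * K" using qK by (rule mult_left_mono) simp
      finally have 2: "- (q \<bullet> w) \<le> norm w * K" .
      have "Fu + Gw + a + b - \<nu> \<bullet> q - q \<bullet> w + v \<bullet> x \<le> M"
        using 1 2 vx unfolding M_def by linarith
      then show "\<epsilon> * (Fu + Gw + a + b - \<nu> \<bullet> q - q \<bullet> w + v \<bullet> x) \<le> \<epsilon> * M"
        using \<epsilon>(1) by (intro mult_left_mono) auto
      have "norm (q + \<epsilon> *\<^sub>R x) \<le> K"
        using norm_triangle_ineq[of q "\<epsilon> *\<^sub>R x"] qnorm xnorm \<epsilon>(1) by (simp add: K_def)
      then have "norm (q + \<epsilon> *\<^sub>R x) * norm (u - w - v) \<le> K * (\<eta> / (2 * K))"
        using \<delta> K by (intro mult_mono) auto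
      with norm_cauchy_schwarz show "(q + \<epsilon> *\<^sub>R x) \<bullet> (u - w - v) \<le> K * (\<eta> / (2 * K))"
        by (rule order_trans)
    qed
    also have "\<dots> < \<eta>" using \<epsilon>(3) K by simp
    finally show ?thesis using zq by blast
  qed
  then have "\<exists>z. norm (z - T z - v) < e" if "0 < e" for e
    using that by (meson power2_less_imp_less less_imp_le zero_less_power)
  then show ?thesis
    by (fastforce simp: closure_approachable dist_norm)
qed

section \<open>Recession functions of conjugates\<close>

text \<open>
  The conjugate is the supremum over \<open>x \<in> dom f\<close> of affine functions of slope \<open>x\<close>. Bounding all
  slopes at once shows that the difference quotients in direction \<open>d\<close> never exceed the supremum of
  \<open>d \<bullet> x\<close>; keeping a single \<open>x\<close> shows that in the limit they reach at least \<open>d \<bullet> x\<close>. A point of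
  \<open>dom f\<^sup>*\<close> must exist, for otherwise the limit in the definition is not determined.
\<close>

lemma recession_fun_conjugate:
  fixes f :: "'a::real_inner \<Rightarrow> ereal"
  assumes proper: "proper_fun f" and ne: "eff_dom (convex_conjugate f) \<noteq> {}"
    and bdd: "bdd_above ((\<lambda>x. d \<bullet> x) ` eff_dom f)"
  shows "recession_fun (convex_conjugate f) d = ereal (SUP x\<in>eff_dom f. d \<bullet> x)"
proof -
  define \<sigma> where "\<sigma> = (SUP x\<in>eff_dom f. d \<bullet> x)"
  let ?q = "\<lambda>\<nu> \<alpha>. (convex_conjugate f (\<nu> + \<alpha> *\<^sub>R d) - convex_conjugate f \<nu>) / ereal \<alpha>"
  have lim: "(?q \<nu> \<longlongrightarrow> ereal \<sigma>) at_top" if \<nu>: "\<nu> \<in> eff_dom (convex_conjugate f)" for \<nu>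
  proof -
    obtain a where a: "convex_conjugate f \<nu> = ereal a" and minor: "affine_minorant f \<nu> a"
      using proper \<nu> by (rule conjugate_affine_minorant)
    have up: "?q \<nu> \<alpha> \<le> ereal \<sigma>" if \<alpha>: "0 < \<alpha>" for \<alpha>
    proof -
      have "convex_conjugate f (\<nu> + \<alpha> *\<^sub>R d) \<le> ereal (a + \<alpha> * \<sigma>)"
        unfolding convex_conjugate_def
      proof (rule SUP_least)
        fix x
        show "ereal ((\<nu> + \<alpha> *\<^sub>R d) \<bullet> x) - f x \<le> ereal (a + \<alpha> * \<sigma>)"
        proof (cases "f x")
          case (real s)
          have "d \<bullet> x \<le> \<sigma>"
            unfolding \<sigma>_def using real bdd by (intro cSUP_upper) (auto intro: eff_domI)
          then have "\<alpha> * (d \<bullet> x) \<le> \<alpha> * \<sigma>" using \<alpha> by simp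
          moreover have "\<nu> \<bullet> x - a \<le> s" using minor real by (metis affine_minorant_def ereal_less_eq(3))
          ultimately show ?thesis using real by (simp add: inner_add_left)
        next
          case MInf
          then show ?thesis using proper by (auto simp: proper_fun_def)
        qed simp
      qed
      then show ?thesis using a \<alpha>
        by (cases "convex_conjugate f (\<nu> + \<alpha> *\<^sub>R d)") (auto simp: field_simps)
    qed
    have low: "ereal (d \<bullet> x + (\<nu> \<bullet> x - s - a) / \<alpha>) \<le> ?q \<nu> \<alpha>"
      if \<alpha>: "0 < \<alpha>" and s: "f x = ereal s" for \<alpha> x s
    proof -
      have "ereal ((\<nu> + \<alpha> *\<^sub>R d) \<bullet> x) - f x \<le> convex_conjugate f (\<nu> + \<alpha> *\<^sub>R d)"
        unfolding convex_conjugate_def by (rule SUP_upper) simp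
      then have "ereal (\<nu> \<bullet> x + \<alpha> * (d \<bullet> x) - s) \<le> convex_conjugate f (\<nu> + \<alpha> *\<^sub>R d)"
        using s by (simp add: inner_add_left)
      moreover have "d \<bullet> x + (\<nu> \<bullet> x - s - a) / \<alpha> = (\<nu> \<bullet> x + \<alpha> * (d \<bullet> x) - s - a) / \<alpha>"
        using \<alpha> by (simp add: field_simps)
      ultimately show ?thesis using a \<alpha>
        by (cases "convex_conjugate f (\<nu> + \<alpha> *\<^sub>R d)") (simp_all add: divide_right_mono)
    qed
    show ?thesis
    proof (rule order_tendstoI)
      fix c assume "ereal \<sigma> < c"
      then show "eventually (\<lambda>\<alpha>. ?q \<nu> \<alpha> < c) at_top"
        by (intro eventually_mono[OF eventually_gt_at_top[of 0]] le_less_trans[OF up])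
    next
      fix c assume c: "c < ereal \<sigma>"
      obtain x s where x: "c < ereal (d \<bullet> x)" and s: "f x = ereal s"
      proof (cases c)
        case (real k)
        have "eff_dom f \<noteq> {}" using proper by (rule eff_dom_nonempty)
        then obtain x where x: "x \<in> eff_dom f" "k < d \<bullet> x"
          using c real bdd unfolding \<sigma>_def by (auto simp: less_cSUP_iff)
        obtain s where "f x = ereal s" using eff_dom_real[OF proper x(1)] .
        then show thesis using that[of x s] real x(2) by simp
      next
        case MInf
        obtain x s where "f x = ereal s" using proper by (rule proper_point)
        then show thesis using that[of x s] MInf by simp
      qed (use c in simp)
      have "((\<lambda>\<alpha>. ereal (d \<bullet> x + (\<nu> \<bullet> x - s - a) / \<alpha>)) \<longlongrightarrow> ereal (d \<bullet> x + 0)) at_top"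
        by (intro tendsto_ereal tendsto_add tendsto_const
              tendsto_divide_0[OF tendsto_const filterlim_at_top_imp_at_infinity] filterlim_ident)
      then have "eventually (\<lambda>\<alpha>. c < ereal (d \<bullet> x + (\<nu> \<bullet> x - s - a) / \<alpha>)) at_top"
        using x by (intro order_tendstoD(1)) auto
      then show "eventually (\<lambda>\<alpha>. c < ?q \<nu> \<alpha>) at_top"
        using eventually_gt_at_top[of 0]
        by (rule eventually_elim2) (rule less_le_trans[OF _ low[OF _ s]])
    qed
  qed
  show ?thesis
    unfolding recession_fun_def \<sigma>_def[symmetric]
  proof (rule the_equality)
    show "\<forall>\<nu>\<in>eff_dom (convex_conjugate f). (?q \<nu> \<longlongrightarrow> ereal \<sigma>) at_top" using lim by blast
    fix r assume r: "\<forall>\<nu>\<in>eff_dom (convex_conjugate f). (?q \<nu> \<longlongrightarrow> r) at_top"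
    obtain \<nu> where \<nu>: "\<nu> \<in> eff_dom (convex_conjugate f)" using ne by blast
    show "r = ereal \<sigma>"
      using tendsto_unique[OF trivial_limit_at_top_linorder bspec[OF r \<nu>] lim[OF \<nu>]] .
  qed
qed

text \<open>
  A strictly separating direction of the two domains improves the dual: the two recession values
  are the two support functions. The gap \<open>c\<close> makes both of them finite, each domain being
  bounded in its direction by any point of the other.
\<close>

lemma separating_direction_dual_improving:
  fixes f g :: "'a::real_inner \<Rightarrow> ereal"
  assumes f: "proper_fun f" "eff_dom (convex_conjugate f) \<noteq> {}"
    and g: "proper_fun g" "eff_dom (convex_conjugate g) \<noteq> {}"
    and c: "0 < c" and sep: "\<And>p. p \<in> dom_diff f g \<Longrightarrow> d \<bullet> p \<le> - c"
  shows "dual_improving_direction f g d"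
proof -
  have sep': "d \<bullet> x + (- d) \<bullet> y \<le> - c" if "x \<in> eff_dom f" "y \<in> eff_dom g" for x y
    using sep[of "x - y"] that by (auto simp: dom_diff_def inner_diff_right)
  obtain x0 y0 where x0: "x0 \<in> eff_dom f" and y0: "y0 \<in> eff_dom g"
    using eff_dom_nonempty[OF f(1)] eff_dom_nonempty[OF g(1)] by blast
  have bf: "bdd_above ((\<lambda>x. d \<bullet> x) ` eff_dom f)"
    using sep'[OF _ y0] by (intro bdd_aboveI2[of _ _ "- c - (- d) \<bullet> y0"]) (simp add: algebra_simps)
  have bg: "bdd_above ((\<lambda>y. (- d) \<bullet> y) ` eff_dom g)"
    using sep'[OF x0] by (intro bdd_aboveI2[of _ _ "- c - d \<bullet> x0"]) (simp add: algebra_simps)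
  have "(SUP x\<in>eff_dom f. d \<bullet> x) \<le> - c - (- d) \<bullet> y" if "y \<in> eff_dom g" for y
    using x0 sep'[OF _ that] by (intro cSUP_least) (auto simp: algebra_simps)
  then have "(SUP y\<in>eff_dom g. (- d) \<bullet> y) \<le> - c - (SUP x\<in>eff_dom f. d \<bullet> x)"
    using y0 by (intro cSUP_least) (auto simp: algebra_simps)
  then show ?thesis
    unfolding dual_improving_direction_def
      recession_fun_conjugate[OF f bf] recession_fun_conjugate[OF g bg]
    using c by simp
qed

theorem corollary5:
  fixes f g :: "real ^ 'n \<Rightarrow> ereal" and d' v :: "real ^ 'n"
  assumes "closed_proper_convex f" and "closed_proper_convex g"
    and "dual_feasible f g"
    and "primal_strongly_infeasible f g"
    and "d' = - closest_point (closure (dom_diff f g)) 0"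
    and "v = - d'"
  shows "v = closest_point (closure (dom_diff f g)) 0 \<and> v \<noteq> 0
    \<and> (\<forall>\<gamma>>0. infimal_displacement (douglas_rachford \<gamma> f g) = v)
    \<and> dual_improving_direction f g d'"
proof -
  let ?D = "closure (dom_diff f g)"
  have v: "v = closest_point ?D 0" using assms(5,6) by simp
  have proper: "proper_fun f" "proper_fun g" and conv: "ext_convex f" "ext_convex g"
    using assms(1,2) by (auto simp: closed_proper_convex_def)
  have D: "convex ?D" "closed ?D"
    using convex_dom_diff[OF conv] by (auto intro: convex_closure)
  obtain x0 y0 where "x0 \<in> eff_dom f" "y0 \<in> eff_dom g"
    using eff_dom_nonempty[OF proper(1)] eff_dom_nonempty[OF proper(2)] by blast
  then have "x0 - y0 \<in> ?D" by (auto simp: dom_diff_def intro!: closure_subset[THEN subsetD])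
  then have "?D \<noteq> {}" by (intro notI) (simp only: empty_iff)
  then have vD: "v \<in> ?D" unfolding v by (rule closest_point_in_set[OF D(2)])
  with assms(4) have v0: "v \<noteq> 0" by (auto simp: primal_strongly_infeasible_def)
  have vmin: "(norm v)\<^sup>2 \<le> v \<bullet> p" if "p \<in> dom_diff f g" for p
    using closest_point_dot[OF D, of p 0] closure_subset that
    by (auto simp: v[symmetric] power2_norm_eq_inner inner_diff_right)
  obtain \<nu> \<mu> where \<nu>: "\<nu> \<in> eff_dom (convex_conjugate f)" and \<mu>: "\<mu> \<in> eff_dom (convex_conjugate g)"
    and "0 = \<nu> + \<mu>"
    using assms(3) unfolding dual_feasible_def by (rule set_plus_elim)
  then have \<mu>\<nu>: "\<mu> = - \<nu>" by (simp add: eq_neg_iff_add_eq_0 add.commute)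
  obtain a where a: "affine_minorant f \<nu> a" using conjugate_affine_minorant[OF proper(1) \<nu>] .
  obtain b where b: "affine_minorant g (- \<nu>) b" using conjugate_affine_minorant[OF proper(2) \<mu>] \<mu>\<nu> by auto
  have "infimal_displacement (douglas_rachford \<gamma> f g) = v" if \<gamma>: "0 < \<gamma>" for \<gamma>
  proof -
    let ?F = "\<lambda>x. ereal \<gamma> * f x" and ?G = "\<lambda>x. ereal \<gamma> * g x"
    let ?T = "douglas_rachford \<gamma> f g"
    let ?R = "closure (range (\<lambda>z. z - ?T z))"
    note F = closed_proper_convex_cmult[OF assms(1) \<gamma>] affine_minorant_cmult[OF a \<gamma>]
    note G = closed_proper_convex_cmult[OF assms(2) \<gamma>] affine_minorant_cmult[OF b \<gamma>]
    have dom: "dom_diff ?F ?G = dom_diff f g"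
      by (simp add: dom_diff_def eff_dom_cmult[OF \<gamma>])
    have "v \<in> ?R"
    proof (rule min_norm_in_closure_displacements[OF F G(1)])
      show "affine_minorant ?G (- (\<gamma> *\<^sub>R \<nu>)) (\<gamma> * b)" using G(2) by simp
      show "v \<in> closure (dom_diff ?F ?G)" using vD by (simp only: dom)
      show "(norm v)\<^sup>2 \<le> v \<bullet> d" if "d \<in> dom_diff ?F ?G" for d
        using that by (intro vmin) (simp only: dom)
    qed (rule douglas_rachford_displacement, rule douglas_rachford_nonexpansive[OF F G])
    have "z - ?T z \<in> dom_diff ?F ?G" for z
    proof -
      have "prox ?F t \<in> eff_dom ?F" "prox ?G t \<in> eff_dom ?G" for t
        using prox_in_eff_dom[OF F] prox_in_eff_dom[OF G] by blast+
      then show ?thesis unfolding douglas_rachford_displacement by (auto simp: dom_diff_def)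
    qed
    then have RD: "?R \<subseteq> ?D" unfolding dom by (intro closure_mono) auto
    let ?c = "closest_point ?R 0"
    \<comment> \<open>The nearest point of the smaller set \<open>?R\<close> is no farther than \<open>v\<close>, so it is also nearest in
      \<open>?D\<close>, where uniqueness holds by convexity.\<close>
    have "?c \<in> ?D" using closest_point_in_set[of ?R 0] \<open>v \<in> ?R\<close> RD closed_closure by blast
    moreover have "dist 0 ?c \<le> dist 0 p" if "p \<in> ?D" for p
      using closest_point_le[of ?R v 0] \<open>v \<in> ?R\<close> closest_point_le[OF D(2) that, of 0] v by auto
    ultimately have "?c = closest_point ?D 0" using closest_point_unique[OF D] by blast
    then show ?thesis by (simp add: infimal_displacement_def v)
  qed
  moreover have "dual_improving_direction f g d'"
  proof (rule separating_direction_dual_improving)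
    show "eff_dom (convex_conjugate f) \<noteq> {}" "eff_dom (convex_conjugate g) \<noteq> {}" using \<nu> \<mu> by auto
    show "0 < (norm v)\<^sup>2" using v0 by simp
    show "d' \<bullet> p \<le> - (norm v)\<^sup>2" if "p \<in> dom_diff f g" for p
      using vmin[OF that] assms(6) by simp
  qed (use proper in auto)
  ultimately show ?thesis using v v0 by blast
qed

end
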